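(* Let $r>0$, $\theta\in[0,1]$, let $A=\begin{pmatrix}\cos 2\pi\theta&-\sin 2\pi\theta\\\sin 2\pi\theta&\cos 2\pi\theta\end{pmatrix}\begin{pmatrix}r&0\\0&r\end{pmatrix}$, and let $T:\mathbb{R}^2\to\mathbb{R}^2$, $Tx=Ax$. (i) If $\theta$ is rational and $r=1$, then all points of $\mathbb{R}^2$ are periodic points. Further, $T$ has strongly dense periodic points in weak topology. (ii) If $\theta$ is irrational or $r\neq1$, then no point of $\mathbb{R}^2$ other than $\begin{pmatrix}0\\0\end{pmatrix}$ is a periodic point. Further, $T$ does not have weakly dense periodic points in weak topology.
   Context: Continuous linear functionals on $\mathbb{R}^2$ are identified with vectors $x^*\in\mathbb{R}^2$ via $\langle x,x^*\rangle=x_1x_1^*+x_2x_2^*$, and $p_{x^*}(x)=|\langle x,x^*\rangle|$. A point $x$ is periodic for $T$ if $T^kx=x$ for some integer $k\ge1$. $T$ has weakly (resp. strongly) dense periodic points in weak topology if for some nonzero $x^*$ (resp. for every nonzero $x^*$) the following holds: for every $x\in\mathbb{R}^2$ and $\varepsilon>0$ there is a periodic point $y\in\mathbb{R}^2$ with $p_{x^*}(x-y)<\varepsilon$. *)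

theory Defs
  imports "HOL-Analysis.Analysis"
begin

definition periodic_point :: "('a \<Rightarrow> 'a) \<Rightarrow> 'a \<Rightarrow> bool" where
  "periodic_point T x \<longleftrightarrow> (\<exists>k::nat. k \<ge> 1 \<and> (T ^^ k) x = x)"

text \<open>A continuous linear functional on the plane is represented by a vector \<open>xs\<close>, acting by
  \<open>x \<bullet> xs = x $ 1 * xs $ 1 + x $ 2 * xs $ 2\<close>.\<close>

definition weak_seminorm :: "real^2 \<Rightarrow> real^2 \<Rightarrow> real" where
  "weak_seminorm xs x = \<bar>x \<bullet> xs\<bar>"

definition dense_periodic_points_along :: "real^2 \<Rightarrow> (real^2 \<Rightarrow> real^2) \<Rightarrow> bool" where
  "dense_periodic_points_along xs T \<longleftrightarrow>
     (\<forall>x. \<forall>\<epsilon>>0. \<exists>y. periodic_point T y \<and> weak_seminorm xs (x - y) < \<epsilon>)"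

definition weakly_dense_periodic_points :: "(real^2 \<Rightarrow> real^2) \<Rightarrow> bool" where
  "weakly_dense_periodic_points T \<longleftrightarrow> (\<exists>xs. xs \<noteq> 0 \<and> dense_periodic_points_along xs T)"

definition strongly_dense_periodic_points :: "(real^2 \<Rightarrow> real^2) \<Rightarrow> bool" where
  "strongly_dense_periodic_points T \<longleftrightarrow> (\<forall>xs. xs \<noteq> 0 \<longrightarrow> dense_periodic_points_along xs T)"

end

theory Submission
  imports Defs
begin

text \<open>Identify the plane with \<open>\<complex>\<close>. Then \<open>T\<close> is multiplication by the complex number
  \<open>w = r cis (2 \<pi> \<theta>)\<close>, so its \<open>k\<close>-th iterate fixes a nonzero vector exactly when \<open>w\<^sup>k = 1\<close>,
  a condition that no longer mentions the vector. Comparing absolute values and arguments, some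
  power of \<open>w\<close> with positive exponent equals \<open>1\<close> if and only if \<open>r = 1\<close> and \<open>k \<theta>\<close> is an
  integer for some \<open>k \<ge> 1\<close>, that is, \<open>\<theta>\<close> is rational (\<open>scaled_cis_root_of_unity_iff\<close>). This
  gives the dichotomy: either every vector is periodic or only the origin is
  (\<open>periodic_point_iff_of_complex_multiplication\<close>).

  Density follows at once. If all vectors are periodic, each vector approximates itself. If only
  the origin is periodic, density along a functional \<open>x\<^sup>*\<close> would say that
  \<open>\<bar>\<langle>x, x\<^sup>*\<rangle>\<bar>\<close> is below every positive bound for every \<open>x\<close>; this forces \<open>x\<^sup>* = 0\<close>.\<close>

definition plane_to_complex :: "real^2 \<Rightarrow> complex" where
  "plane_to_complex x = Complex (x $ 1) (x $ 2)"

lemma plane_to_complex_eq_iff: "plane_to_complex x = plane_to_complex y \<longleftrightarrow> x = y"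
  by (auto simp: plane_to_complex_def vec_eq_iff forall_2)

lemma plane_to_complex_eq_0_iff: "plane_to_complex x = 0 \<longleftrightarrow> x = 0"
  by (auto simp: plane_to_complex_def complex_eq_iff vec_eq_iff forall_2)

lemma plane_to_complex_rotation_scaling:
  "plane_to_complex (((vector [vector [cos t, - sin t], vector [sin t, cos t]] :: real^2^2)
       ** (vector [vector [r, 0], vector [0, r]] :: real^2^2)) *v x)
     = of_real r * cis t * plane_to_complex x"
  by (simp add: plane_to_complex_def complex_eq_iff matrix_vector_mult_def matrix_matrix_mult_def
      sum_2 algebra_simps)

lemma funpow_semiconj_mult:
  fixes w :: "'b::comm_monoid_mult"
  assumes "\<And>x. f (T x) = w * f x"
  shows "f ((T ^^ k) x) = w ^ k * f x"
  by (induction k) (simp_all add: assms mult.assoc)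

text \<open>For \<open>x \<noteq> 0\<close> the equation \<open>w\<^sup>k z = z\<close> can be cancelled by the nonzero complex number
  \<open>z\<close> that represents \<open>x\<close>, so the period depends only on \<open>w\<close>.\<close>

lemma periodic_point_iff_of_complex_multiplication:
  assumes "\<And>x. plane_to_complex (T x) = w * plane_to_complex x"
  shows "periodic_point T x \<longleftrightarrow> x = 0 \<or> (\<exists>k\<ge>1. w ^ k = 1)"
proof -
  have "(T ^^ k) x = x \<longleftrightarrow> x = 0 \<or> w ^ k = 1" for k
    using funpow_semiconj_mult[of plane_to_complex T w k x, OF assms]
    by (metis mult_cancel_right1 plane_to_complex_eq_0_iff plane_to_complex_eq_iff)
  then show ?thesis
    unfolding periodic_point_def by auto
qed

lemma cis_two_pi_eq_1_iff: "cis (2 * pi * t) = 1 \<longleftrightarrow> t \<in> \<int>"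
proof
  assume "cis (2 * pi * t) = 1"
  then have "cos (2 * pi * t) = 1"
    by (simp add: complex_eq_iff)
  then obtain n :: int where "2 * pi * t = n * (2 * pi)"
    by (auto simp: cos_one_2pi_int)
  then show "t \<in> \<int>"
    by simp
qed (rule cis_multiple_2pi)

lemma in_Rats_iff_multiple_in_Ints:
  fixes t :: real
  shows "t \<in> \<rat> \<longleftrightarrow> (\<exists>k\<ge>1. of_nat k * t \<in> \<int>)"
proof
  assume "t \<in> \<rat>"
  then obtain a b :: int where "b > 0" "t = a / b"
    by (auto elim: Rats_cases')
  then have "of_nat (nat b) * t = of_int a" "nat b \<ge> 1"
    by auto
  then show "\<exists>k\<ge>1. of_nat k * t \<in> \<int>"
    by (metis Ints_of_int)
next
  assume "\<exists>k\<ge>1. of_nat k * t \<in> \<int>"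
  then obtain k :: nat and n :: int where "k \<ge> 1" "of_nat k * t = of_int n"
    by (auto elim: Ints_cases)
  then have "t = of_int n / of_nat k"
    by (simp add: field_simps)
  then show "t \<in> \<rat>"
    by simp
qed

text \<open>The absolute value of a root of unity is \<open>1\<close>, and a positive real number with a power of
  positive exponent equal to \<open>1\<close> is itself \<open>1\<close>; what remains is a statement about the argument alone.\<close>

lemma scaled_cis_root_of_unity_iff:
  assumes "r > 0"
  shows "(\<exists>k\<ge>1. (of_real r * cis (2 * pi * \<theta>)) ^ k = 1) \<longleftrightarrow> \<theta> \<in> \<rat> \<and> r = 1"
proof -
  have "(of_real r * cis (2 * pi * \<theta>)) ^ k = 1 \<longleftrightarrow> r = 1 \<and> of_nat k * \<theta> \<in> \<int>" if "k \<ge> 1" for k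
  proof -
    have "r = 1" if eq: "(of_real r * cis (2 * pi * \<theta>)) ^ k = 1"
    proof -
      have "norm ((of_real r * cis (2 * pi * \<theta>)) ^ k) = r ^ k"
        using assms by (simp add: norm_power norm_mult)
      then have "r ^ k = 1"
        using eq by simp
      then show ?thesis
        using assms \<open>k \<ge> 1\<close> power_eq_1_iff[of r k] by simp
    qed
    moreover have "cis (2 * pi * \<theta>) ^ k = 1 \<longleftrightarrow> of_nat k * \<theta> \<in> \<int>"
      using cis_two_pi_eq_1_iff[of "of_nat k * \<theta>"] by (simp add: Complex.DeMoivre mult_ac)
    ultimately show ?thesis
      by auto
  qed
  then show ?thesis
    unfolding in_Rats_iff_multiple_in_Ints by auto
qed

lemma strongly_dense_if_all_periodic:
  assumes "\<And>x. periodic_point T x"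
  shows "strongly_dense_periodic_points T"
  unfolding strongly_dense_periodic_points_def dense_periodic_points_along_def
proof (intro allI impI)
  fix xs x :: "real^2" and \<epsilon> :: real
  assume "\<epsilon> > 0"
  then show "\<exists>y. periodic_point T y \<and> weak_seminorm xs (x - y) < \<epsilon>"
    using assms by (intro exI[of _ x]) (simp add: weak_seminorm_def)
qed

text \<open>The functional \<open>x\<^sup>*\<close> takes the positive value \<open>\<langle>x\<^sup>*, x\<^sup>*\<rangle>\<close> at \<open>x\<^sup>*\<close> itself,
  so the origin cannot approximate \<open>x\<^sup>*\<close> to within that value.\<close>

lemma not_weakly_dense_if_only_0_periodic:
  assumes "\<And>x. x \<noteq> 0 \<Longrightarrow> \<not> periodic_point T x"
  shows "\<not> weakly_dense_periodic_points T"
proof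
  assume "weakly_dense_periodic_points T"
  then obtain xs where "xs \<noteq> 0" "dense_periodic_points_along xs T"
    unfolding weakly_dense_periodic_points_def by auto
  then obtain y where "periodic_point T y" and less: "weak_seminorm xs (xs - y) < xs \<bullet> xs"
    unfolding dense_periodic_points_along_def by (meson inner_gt_zero_iff)
  then have "y = 0"
    using assms by auto
  then show False
    using less by (simp add: weak_seminorm_def)
qed

theorem theorem4p3:
  fixes r \<theta> :: real and A :: "real^2^2" and T :: "real^2 \<Rightarrow> real^2"
  assumes "r > 0" and "\<theta> \<in> {0..1}"
    and "A = (vector [vector [cos (2 * pi * \<theta>), - sin (2 * pi * \<theta>)],
                      vector [sin (2 * pi * \<theta>), cos (2 * pi * \<theta>)]] :: real^2^2)
             ** (vector [vector [r, 0], vector [0, r]] :: real^2^2)"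
    and "\<And>x. T x = A *v x"
  shows "(\<theta> \<in> \<rat> \<and> r = 1 \<longrightarrow>
            (\<forall>x. periodic_point T x) \<and> strongly_dense_periodic_points T)
       \<and> (\<theta> \<notin> \<rat> \<or> r \<noteq> 1 \<longrightarrow>
            (\<forall>x. x \<noteq> 0 \<longrightarrow> \<not> periodic_point T x) \<and> \<not> weakly_dense_periodic_points T)"
proof -
  have "plane_to_complex (T x) = (of_real r * cis (2 * pi * \<theta>)) * plane_to_complex x" for x
    by (simp only: assms(3,4) plane_to_complex_rotation_scaling)
  then have periodic_iff: "periodic_point T x \<longleftrightarrow> x = 0 \<or> \<theta> \<in> \<rat> \<and> r = 1" for x
    using periodic_point_iff_of_complex_multiplication scaled_cis_root_of_unity_iff[OF assms(1)]
    by metis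
  show ?thesis
    using strongly_dense_if_all_periodic[of T] not_weakly_dense_if_only_0_periodic[of T]
    by (auto simp: periodic_iff)
qed

end
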